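(* Let $\Sigma=(\mathbb{R}^{n},U,\mathcal{U},f)$ be a control system whose input space is a hyper-rectangle $U=[a_1,b_1]\times\cdots\times[a_m,b_m]$ with $a_i<b_i$ for $i=1,\dots,m$, containing the origin, and whose class of inputs $\mathcal{U}$ contains, for every $u\in U$, the constant input with value $u$. Let $\varepsilon>0$ be any desired precision. Suppose that $\Sigma$ is incrementally input-to-state stable ($\delta$-ISS), and let $\beta$ (of class $\mathcal{KL}$) and $\gamma$ (of class $\mathcal{K}_\infty$) be functions as in the definition of $\delta$-ISS, i.e. $\|\mathbf{x}(t,x,\mathbf{u})-\mathbf{x}(t,y,\mathbf{v})\|\le\beta(\|x-y\|,t)+\gamma(\|\mathbf{u}-\mathbf{v}\|_\infty)$ for all $t\ge0$, all $x,y\in\mathbb{R}^n$ and all $\mathbf{u},\mathbf{v}\in\mathcal{U}$. Then for any $\tau>0$, $\eta>0$ and $\mu>0$ satisfying $$\beta(\varepsilon,\tau)+\gamma(\mu)+\eta/2\le\varepsilon,$$ the transition system $T_{\mathcal{U}_\tau}(\Sigma)$ is $\varepsilon$-bisimilar to the transition system $T_{\tau,\eta,\mu}(\Sigma)$.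
   Context: **Notation.** $\|\cdot\|$ is the infinity norm on $\mathbb{R}^n$ and $\mathbb{R}^m$; for a measurable function $g$ of time, $\|g\|_\infty$ is the essential supremum of $\|g(t)\|$ over $t\ge0$. For $A\subseteq\mathbb{R}^k$ and $\mu>0$, $[A]_\mu:=\{a\in A : a_i=k_i\mu,\ k_i\in\mathbb{Z}\text{ for every coordinate } i\}$. A continuous function $\gamma:[0,\infty)\to[0,\infty)$ is of class $\mathcal{K}$ if it is strictly increasing with $\gamma(0)=0$, and of class $\mathcal{K}_\infty$ if moreover $\gamma(r)\to\infty$ as $r\to\infty$. A continuous function $\beta:[0,\infty)\times[0,\infty)\to[0,\infty)$ is of class $\mathcal{KL}$ if for each fixed $s$ the map $r\mapsto\beta(r,s)$ is of class $\mathcal{K}_\infty$, and for each fixed $r$ the map $s\mapsto\beta(r,s)$ is decreasing with $\beta(r,s)\to0$ as $s\to\infty$. For a relation $R\subseteq A\times B$, $R(A)=\{b\in B:\exists a\in A,\ (a,b)\in R\}$ and $R^{-1}(B)=\{a\in A:\exists b\in B,\ (a,b)\in R\}$. **Control systems.** A control system is a quadruple $\Sigma=(\mathbb{R}^n,U,\mathcal{U},f)$ where $U\subseteq\mathbb{R}^m$ is the input space; $\mathcal{U}$ is a subset of the set of all locally essentially bounded (measurable) functions of time from intervals $]a,b[\subseteq\mathbb{R}$ with $a<0<b$ to $U$; and $f:\mathbb{R}^n\times U\to\mathbb{R}^n$ is continuous and such that for every compact $K\subset\mathbb{R}^n$ there is $\kappa>0$ with $\|f(x,u)-f(y,u)\|\le\kappa\|x-y\|$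 for all $x,y\in K$, $u\in U$. A locally absolutely continuous curve $\mathbf{x}:]a,b[\to\mathbb{R}^n$ is a trajectory of $\Sigma$ if there is $\mathbf{u}\in\mathcal{U}$ with $\dot{\mathbf{x}}(t)=f(\mathbf{x}(t),\mathbf{u}(t))$ for almost all $t\in]a,b[$. $\mathbf{x}(t,x,\mathbf{u})$ denotes the (uniquely determined) point reached at time $t$ under input $\mathbf{u}$ from initial condition $x$ (at time $0$). $\Sigma$ is forward complete if every trajectory is defined on an interval of the form $]a,\infty[$. **$\delta$-ISS.** $\Sigma$ is $\delta$-ISS if it is forward complete and there are a $\mathcal{KL}$ function $\beta$ and a $\mathcal{K}_\infty$ function $\gamma$ such that $\|\mathbf{x}(t,x,\mathbf{u})-\mathbf{x}(t,y,\mathbf{v})\|\le\beta(\|x-y\|,t)+\gamma(\|\mathbf{u}-\mathbf{v}\|_\infty)$ for all $t\ge0$, $x,y\in\mathbb{R}^n$, $\mathbf{u},\mathbf{v}\in\mathcal{U}$. **Transition systems.** A transition system is a quintuple $T=(Q,L,\longrightarrow,O,H)$: a set of states $Q$, a set of labels $L$, a transition relation $\longrightarrow\subseteq Q\times L\times Q$ (one writes $q\xrightarrow{l}p$ for $(q,l,p)\in\longrightarrow$), an output set $O$ and an output function $H:Q\to O$. It is metric if $O$ is equipped with a metric $\mathbf{d}$. **Approximate bisimulation.** Let $T_i=(Q_i,L_i,\longrightarrow_i,O,H_i)$, $i=1,2$, be metric transition systems with the same output set $O$ and metric $\mathbf{d}$, and let $\varepsilon\ge0$. A relation $R\subseteq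 Q_1\times Q_2$ is an $\varepsilon$-approximate bisimulation relation between $T_1$ and $T_2$ if for every $(q_1,q_2)\in R$: (i) $\mathbf{d}(H_1(q_1),H_2(q_2))\le\varepsilon$; (ii) $q_1\xrightarrow{l_1}_1p_1$ implies existence of $q_2\xrightarrow{l_2}_2p_2$ with $(p_1,p_2)\in R$; (iii) $q_2\xrightarrow{l_2}_2p_2$ implies existence of $q_1\xrightarrow{l_1}_1p_1$ with $(p_1,p_2)\in R$. (The labels $l_1,l_2$ need not coincide.) $T_1$ is $\varepsilon$-bisimilar to $T_2$ if there is an $\varepsilon$-approximate bisimulation relation $R$ between them with $R(Q_1)=Q_2$ and $R^{-1}(Q_2)=Q_1$. **Digital inputs.** For $\tau>0$ only inputs in $\mathcal{U}_\tau=\{\mathbf{u}\in\mathcal{U}:\mathbf{u}(t)=\mathbf{u}(0),\ t\in[0,\tau]\}$ are used. A vector $u\in U$ is identified with the constant input with value $u$ (so $\mathbf{x}(\tau,x,u)$ is the state reached at time $\tau$ from $x$ under the constant input $u$, and $\|u-v\|_\infty=\|u-v\|$ for $u,v\in U$). **The transition system $T_{\mathcal{U}_\tau}(\Sigma)$.** $T_{\mathcal{U}_\tau}(\Sigma)=(Q_1,L_1,\longrightarrow_1,O_1,H_1)$ with $Q_1=\mathbb{R}^n$; $L_1=\{l_1\in U : \mathbf{x}(\tau,x,l_1)\text{ is defined for all }x\in\mathbb{R}^n\}$; $q\xrightarrow{l}_1p$ iff $\mathbf{x}(\tau,q,l)=p$; $O_1=\mathbb{R}^n$ with metric $\mathbf{d}(p,q)=\|p-q\|$;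 $H_1$ the identity. **The transition system $T_{\tau,\eta,\mu}(\Sigma)$.** $T_{\tau,\eta,\mu}(\Sigma)=(Q_2,L_2,\longrightarrow_2,O_2,H_2)$ with $Q_2=[\mathbb{R}^n]_\eta$; $L_2=[L_1]_\mu$ (with $L_1\subseteq U\subseteq\mathbb{R}^m$ the label set of $T_{\mathcal{U}_\tau}(\Sigma)$); $q\xrightarrow{l}_2p$ (for $l\in L_2$) iff $\|p-\mathbf{x}(\tau,q,l)\|\le\eta/2$; $O_2=\mathbb{R}^n$ with metric $\mathbf{d}(p,q)=\|p-q\|$; $H_2:Q_2\hookrightarrow O_2$ the inclusion map. *)

theory Defs
  imports "HOL-Analysis.Analysis" "HOL-Probability.Essential_Supremum"
begin

text \<open>
  The norm on \<open>real ^ 'k\<close> used throughout is the infinity norm, i.e. the library constant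
  \<^const>\<open>infnorm\<close>; the type class norm on \<open>real ^ 'k\<close> is the Euclidean one.
\<close>

section \<open>Comparison functions and lattices\<close>

text \<open>Functions on \<open>[0,\<infinity>)\<close> are total functions on the reals, constrained on \<open>{0..}\<close> only.\<close>

definition class_K :: "(real \<Rightarrow> real) \<Rightarrow> bool" where
  "class_K \<gamma> \<longleftrightarrow> \<gamma> ` {0..} \<subseteq> {0..} \<and> continuous_on {0..} \<gamma> \<and> strict_mono_on {0..} \<gamma> \<and> \<gamma> 0 = 0"

definition class_Kinf :: "(real \<Rightarrow> real) \<Rightarrow> bool" where
  "class_Kinf \<gamma> \<longleftrightarrow> class_K \<gamma> \<and> filterlim \<gamma> at_top at_top"

text \<open>
  ``Decreasing'' in the second argument is necessarily non-strict, since \<open>\<beta> 0 s = 0\<close> for all \<open>s\<close>.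
\<close>

definition class_KL :: "(real \<Rightarrow> real \<Rightarrow> real) \<Rightarrow> bool" where
  "class_KL \<beta> \<longleftrightarrow>
     continuous_on ({0..} \<times> {0..}) (\<lambda>(r, s). \<beta> r s) \<and>
     (\<forall>s\<ge>0. class_Kinf (\<lambda>r. \<beta> r s)) \<and>
     (\<forall>r\<ge>0. antimono_on {0..} (\<beta> r) \<and> (\<beta> r \<longlongrightarrow> 0) at_top)"

definition lattice_points :: "(real ^ 'k) set \<Rightarrow> real \<Rightarrow> (real ^ 'k) set" where
  "lattice_points A \<mu> = {a \<in> A. \<forall>i. \<exists>k::int. a $ i = of_int k * \<mu>}"


section \<open>Control systems\<close>

definition abs_continuous_on_Icc :: "real \<Rightarrow> real \<Rightarrow> (real \<Rightarrow> real ^ 'n) \<Rightarrow> bool" where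
  "abs_continuous_on_Icc c d x \<longleftrightarrow>
     (\<forall>e>0. \<exists>\<delta>>0. \<forall>(N::nat) s t.
        (\<forall>i<N. c \<le> s i \<and> s i \<le> t i \<and> t i \<le> d) \<and>
        (\<forall>i<N. \<forall>j<N. i \<noteq> j \<longrightarrow> {s i<..<t i} \<inter> {s j<..<t j} = {}) \<and>
        (\<Sum>i<N. t i - s i) < \<delta> \<longrightarrow>
        (\<Sum>i<N. infnorm (x (t i) - x (s i))) < e)"

definition locally_abs_continuous_on :: "real set \<Rightarrow> (real \<Rightarrow> real ^ 'n) \<Rightarrow> bool" where
  "locally_abs_continuous_on I x \<longleftrightarrow> (\<forall>c d. {c..d} \<subseteq> I \<longrightarrow> abs_continuous_on_Icc c d x)"

text \<open>
  An input is a partial function of time whose domain is the interval \<open>]a,b[\<close> on which it is given.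
  The end points are extended reals, so that intervals such as \<open>]a,\<infinity>[\<close> are included.
\<close>

record ('n, 'm) control_system =
  input_space :: "(real ^ 'm::finite) set"
  inputs :: "(real \<rightharpoonup> real ^ 'm) set"
  dynamics :: "real ^ 'n::finite \<Rightarrow> real ^ 'm \<Rightarrow> real ^ 'n"

definition admissible_input :: "(real ^ 'm) set \<Rightarrow> (real \<rightharpoonup> real ^ 'm) \<Rightarrow> bool" where
  "admissible_input U u \<longleftrightarrow>
     (\<exists>a b. a < 0 \<and> 0 < b \<and> dom u = einterval a b) \<and>
     ran u \<subseteq> U \<and>
     (\<lambda>t. the (u t)) \<in> borel_measurable (lebesgue_on (dom u)) \<and>
     (\<forall>K. compact K \<and> K \<subseteq> dom u \<longrightarrow>
        (\<exists>C::real. AE t in lebesgue_on K. infnorm (the (u t)) \<le> C))"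

definition is_control_system :: "('n::finite, 'm::finite) control_system \<Rightarrow> bool" where
  "is_control_system S \<longleftrightarrow>
     (\<forall>u\<in>inputs S. admissible_input (input_space S) u) \<and>
     continuous_on (UNIV \<times> input_space S) (\<lambda>(x, u). dynamics S x u) \<and>
     (\<forall>K. compact K \<longrightarrow>
        (\<exists>\<kappa>>0. \<forall>x\<in>K. \<forall>y\<in>K. \<forall>u\<in>input_space S.
           infnorm (dynamics S x u - dynamics S y u) \<le> \<kappa> * infnorm (x - y)))"

text \<open>
  \<open>x\<close> restricted to \<open>]a,b[\<close> is a trajectory under the input \<open>u\<close>; values of \<open>x\<close> outside \<open>]a,b[\<close>
  are irrelevant.
\<close>

definition trajectory_under ::
  "('n::finite, 'm::finite) control_system \<Rightarrow> (real \<rightharpoonup> real ^ 'm) \<Rightarrow> ereal \<Rightarrow> ereal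
     \<Rightarrow> (real \<Rightarrow> real ^ 'n) \<Rightarrow> bool" where
  "trajectory_under S u a b x \<longleftrightarrow>
     a < 0 \<and> 0 < b \<and> u \<in> inputs S \<and> einterval a b \<subseteq> dom u \<and>
     locally_abs_continuous_on (einterval a b) x \<and>
     (AE t in lebesgue_on (einterval a b).
        (x has_vector_derivative dynamics S (x t) (the (u t))) (at t))"

text \<open>
  Restrictions of trajectories are trajectories, so ``every trajectory is defined on an interval
  \<open>]a,\<infinity>[\<close>'' is read as: every trajectory can be continued, under the same input, to a trajectory
  on an interval unbounded to the right.
\<close>

definition forward_complete :: "('n::finite, 'm::finite) control_system \<Rightarrow> bool" where
  "forward_complete S \<longleftrightarrow>
     (\<forall>u a b x. trajectory_under S u a b x \<longrightarrow>
        (\<exists>y. trajectory_under S u a \<infinity> y \<and> (\<forall>t\<in>einterval a b. y t = x t)))"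

definition reaches ::
  "('n::finite, 'm::finite) control_system \<Rightarrow> real \<Rightarrow> real ^ 'n \<Rightarrow> (real \<rightharpoonup> real ^ 'm)
     \<Rightarrow> real ^ 'n \<Rightarrow> bool" where
  "reaches S t x\<^sub>0 u p \<longleftrightarrow>
     (\<exists>a b x. trajectory_under S u a b x \<and> t \<in> einterval a b \<and> x 0 = x\<^sub>0 \<and> x t = p)"

definition flow_defined ::
  "('n::finite, 'm::finite) control_system \<Rightarrow> real \<Rightarrow> real ^ 'n \<Rightarrow> (real \<rightharpoonup> real ^ 'm) \<Rightarrow> bool" where
  "flow_defined S t x\<^sub>0 u \<longleftrightarrow> (\<exists>p. reaches S t x\<^sub>0 u p)"

text \<open>The point reached is unique by the Lipschitz condition on the dynamics.\<close>

definition flow ::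
  "('n::finite, 'm::finite) control_system \<Rightarrow> real \<Rightarrow> real ^ 'n \<Rightarrow> (real \<rightharpoonup> real ^ 'm) \<Rightarrow> real ^ 'n" where
  "flow S t x\<^sub>0 u = (THE p. reaches S t x\<^sub>0 u p)"

definition constant_input :: "real ^ 'm \<Rightarrow> (real \<rightharpoonup> real ^ 'm)" where
  "constant_input u = (\<lambda>t. Some u)"


section \<open>Incremental input-to-state stability\<close>

definition sup_norm_diff :: "(real \<rightharpoonup> real ^ 'm) \<Rightarrow> (real \<rightharpoonup> real ^ 'm) \<Rightarrow> ereal" where
  "sup_norm_diff u v = esssup (lebesgue_on {0..}) (\<lambda>t. ereal (infnorm (the (u t) - the (v t))))"

text \<open>
  Inputs are only locally essentially bounded, so \<open>\<parallel>u - v\<parallel>\<^sub>\<infinity>\<close> may be infinite; the estimate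
  then holds trivially, as \<open>\<gamma>\<close> is unbounded.  Under forward completeness inputs are defined
  on all of \<open>{0..}\<close>.
\<close>

definition delta_ISS_estimate ::
  "('n::finite, 'm::finite) control_system \<Rightarrow> (real \<Rightarrow> real \<Rightarrow> real) \<Rightarrow> (real \<Rightarrow> real) \<Rightarrow> bool" where
  "delta_ISS_estimate S \<beta> \<gamma> \<longleftrightarrow>
     (\<forall>t\<ge>0. \<forall>x y. \<forall>u\<in>inputs S. \<forall>v\<in>inputs S. sup_norm_diff u v \<noteq> \<infinity> \<longrightarrow>
        infnorm (flow S t x u - flow S t y v)
          \<le> \<beta> (infnorm (x - y)) t + \<gamma> (real_of_ereal (sup_norm_diff u v)))"

definition delta_ISS :: "('n::finite, 'm::finite) control_system \<Rightarrow> bool" where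
  "delta_ISS S \<longleftrightarrow> forward_complete S \<and>
     (\<exists>\<beta> \<gamma>. class_KL \<beta> \<and> class_Kinf \<gamma> \<and> delta_ISS_estimate S \<beta> \<gamma>)"


section \<open>Metric transition systems and approximate bisimulation\<close>

record ('q, 'l, 'o) transition_system =
  states :: "'q set"
  labels :: "'l set"
  transitions :: "('q \<times> 'l \<times> 'q) set"
  outputs :: "'o set"
  output_dist :: "'o \<Rightarrow> 'o \<Rightarrow> real"
  output_map :: "'q \<Rightarrow> 'o"

definition metric_transition_system :: "('q, 'l, 'o) transition_system \<Rightarrow> bool" where
  "metric_transition_system T \<longleftrightarrow>
     transitions T \<subseteq> states T \<times> labels T \<times> states T \<and>
     output_map T ` states T \<subseteq> outputs T \<and>
     Metric_space (outputs T) (output_dist T)"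

definition same_outputs ::
  "('q1, 'l1, 'o) transition_system \<Rightarrow> ('q2, 'l2, 'o) transition_system \<Rightarrow> bool" where
  "same_outputs T\<^sub>1 T\<^sub>2 \<longleftrightarrow> outputs T\<^sub>1 = outputs T\<^sub>2 \<and>
     (\<forall>p\<in>outputs T\<^sub>1. \<forall>q\<in>outputs T\<^sub>1. output_dist T\<^sub>1 p q = output_dist T\<^sub>2 p q)"

definition approx_bisimulation ::
  "real \<Rightarrow> ('q1, 'l1, 'o) transition_system \<Rightarrow> ('q2, 'l2, 'o) transition_system
     \<Rightarrow> ('q1 \<times> 'q2) set \<Rightarrow> bool" where
  "approx_bisimulation \<epsilon> T\<^sub>1 T\<^sub>2 R \<longleftrightarrow>
     R \<subseteq> states T\<^sub>1 \<times> states T\<^sub>2 \<and>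
     (\<forall>(q\<^sub>1, q\<^sub>2)\<in>R.
        output_dist T\<^sub>1 (output_map T\<^sub>1 q\<^sub>1) (output_map T\<^sub>2 q\<^sub>2) \<le> \<epsilon> \<and>
        (\<forall>l\<^sub>1 p\<^sub>1. (q\<^sub>1, l\<^sub>1, p\<^sub>1) \<in> transitions T\<^sub>1 \<longrightarrow>
           (\<exists>l\<^sub>2 p\<^sub>2. (q\<^sub>2, l\<^sub>2, p\<^sub>2) \<in> transitions T\<^sub>2 \<and> (p\<^sub>1, p\<^sub>2) \<in> R)) \<and>
        (\<forall>l\<^sub>2 p\<^sub>2. (q\<^sub>2, l\<^sub>2, p\<^sub>2) \<in> transitions T\<^sub>2 \<longrightarrow>
           (\<exists>l\<^sub>1 p\<^sub>1. (q\<^sub>1, l\<^sub>1, p\<^sub>1) \<in> transitions T\<^sub>1 \<and> (p\<^sub>1, p\<^sub>2) \<in> R)))"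

definition approx_bisimilar ::
  "real \<Rightarrow> ('q1, 'l1, 'o) transition_system \<Rightarrow> ('q2, 'l2, 'o) transition_system \<Rightarrow> bool" where
  "approx_bisimilar \<epsilon> T\<^sub>1 T\<^sub>2 \<longleftrightarrow>
     metric_transition_system T\<^sub>1 \<and> metric_transition_system T\<^sub>2 \<and> same_outputs T\<^sub>1 T\<^sub>2 \<and>
     (\<exists>R. approx_bisimulation \<epsilon> T\<^sub>1 T\<^sub>2 R \<and>
          R `` states T\<^sub>1 = states T\<^sub>2 \<and> R\<inverse> `` states T\<^sub>2 = states T\<^sub>1)"


section \<open>The transition systems of a sampled control system\<close>

definition sampled_labels ::
  "real \<Rightarrow> ('n::finite, 'm::finite) control_system \<Rightarrow> (real ^ 'm) set" where
  "sampled_labels \<tau> S = {l \<in> input_space S. \<forall>x. flow_defined S \<tau> x (constant_input l)}"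

definition sampled_system ::
  "real \<Rightarrow> ('n::finite, 'm::finite) control_system
     \<Rightarrow> (real ^ 'n, real ^ 'm, real ^ 'n) transition_system" where
  "sampled_system \<tau> S = \<lparr>
     states = UNIV,
     labels = sampled_labels \<tau> S,
     transitions = {(q, l, p). l \<in> sampled_labels \<tau> S \<and> flow S \<tau> q (constant_input l) = p},
     outputs = UNIV,
     output_dist = (\<lambda>p q. infnorm (p - q)),
     output_map = (\<lambda>q. q)\<rparr>"

definition quantized_system ::
  "real \<Rightarrow> real \<Rightarrow> real \<Rightarrow> ('n::finite, 'm::finite) control_system
     \<Rightarrow> (real ^ 'n, real ^ 'm, real ^ 'n) transition_system" where
  "quantized_system \<tau> \<eta> \<mu> S = \<lparr>
     states = lattice_points UNIV \<eta>,
     labels = lattice_points (sampled_labels \<tau> S) \<mu>,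
     transitions = {(q, l, p). q \<in> lattice_points UNIV \<eta> \<and> p \<in> lattice_points UNIV \<eta> \<and>
       l \<in> lattice_points (sampled_labels \<tau> S) \<mu> \<and>
       infnorm (p - flow S \<tau> q (constant_input l)) \<le> \<eta> / 2},
     outputs = UNIV,
     output_dist = (\<lambda>p q. infnorm (p - q)),
     output_map = (\<lambda>q. q)\<rparr>"

end

theory Submission
  imports Defs
begin

text \<open>
  Let \<open>R\<close> relate a state \<open>x\<close> to a lattice point \<open>q\<close> whenever \<open>\<parallel>x - q\<parallel> \<le> \<epsilon>\<close>.  If the sampled system
  moves from \<open>x\<close> to \<open>p\<close> under \<open>u\<close>, pick a lattice input \<open>v\<close> with \<open>\<parallel>u - v\<parallel> \<le> \<mu>\<close> and let \<open>p'\<close> be a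
  lattice point within \<open>\<eta> / 2\<close> of the point reached from \<open>q\<close> under \<open>v\<close>.  The incremental stability
  estimate bounds the distance of the two reached points by \<open>\<beta> \<epsilon> \<tau> + \<gamma> \<mu>\<close>, so the hypothesis on
  the parameters gives \<open>\<parallel>p - p'\<parallel> \<le> \<epsilon>\<close>.  Conversely, a move of the quantized system
  under \<open>v\<close> is matched by the move of the sampled system under the same \<open>v\<close>.

  Two points need an argument.  First, \<open>v\<close> has to exist inside the input box, whose size may be
  smaller than \<open>\<mu>\<close> and whose corners need not be lattice points.  Rounding every coordinate of \<open>u\<close>
  towards zero works, because the box contains the origin (\<open>ex_near_lattice_point_box\<close>).
  Secondly, \<open>v\<close> has to be a label, i.e. the flow under \<open>v\<close> must be defined up to time \<open>\<tau>\<close> from every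
  state.  Forward completeness only continues trajectories that exist already, so a trajectory on
  some small interval around \<open>0\<close> has to be supplied first; this is the Picard-Lindeloef theorem
  for the locally Lipschitz vector field that belongs to a constant input
  (\<open>flow_defined_constant_input\<close>).

  The transitions and the stability estimate are stated with the same function \<^const>\<open>flow\<close>, so
  the estimate applies to the transitions as they stand.
\<close>

section \<open>Local existence for autonomous differential equations\<close>

text \<open>
  The solution is the fixed point of the Picard operator, a contraction on bounded continuous
  functions.  To have these on the whole line, time is clamped to \<open>[-h, h]\<close>.  The integral from \<open>0\<close>
  to \<open>t\<close> is written as a difference of two integrals that start at \<open>-h\<close>, which treats both signs of
  \<open>t\<close> at once; each of the two contributes \<open>2 * h * K\<close> to the contraction factor.
\<close>

lemma picard_lindeloef_global_lipschitz:
  fixes g :: "'a::euclidean_space \<Rightarrow> 'a"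
  assumes g: "K-lipschitz_on UNIV g" and h: "0 < h" and hK: "4 * h * K < 1"
  obtains \<phi> where "\<phi> 0 = x\<^sub>0"
    and "\<And>t. t \<in> {-h<..<h} \<Longrightarrow> (\<phi> has_vector_derivative g (\<phi> t)) (at t)"
proof -
  define c where "c t = max (-h) (min h t)" for t
  have c_in: "c t \<in> {-h..h}" for t using h by (auto simp: c_def)
  have c_id: "c t = t" if "t \<in> {-h..h}" for t using that by (auto simp: c_def)
  have c_cont: "continuous_on UNIV c" unfolding c_def by (intro continuous_intros)
  have K0: "0 \<le> K" using g by (rule lipschitz_on_nonneg)
  have g_cont: "continuous_on A g" for A
    using lipschitz_on_continuous_on[OF g] continuous_on_subset by blast
  define I where "I \<phi> t = integral {-h..t} (\<lambda>s. g (\<phi> s))" for \<phi> :: "real \<Rightarrow> 'a" and t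
  define P where "P \<phi> t = x\<^sub>0 + I \<phi> (c t) - I \<phi> 0" for \<phi> :: "real \<Rightarrow> 'a" and t
  have g\<phi>_cont: "continuous_on A (\<lambda>s. g (\<phi> s))" if "continuous_on UNIV \<phi>" for \<phi> A
    using continuous_on_compose2[OF g_cont[of UNIV] that] continuous_on_subset by blast
  have I_cont: "continuous_on {-h..h} (I \<phi>)" if "continuous_on UNIV \<phi>" for \<phi>
    unfolding I_def
    by (intro indefinite_integral_continuous_1 integrable_continuous_real g\<phi>_cont that)
  have P_bcont: "P \<phi> \<in> bcontfun" if "continuous_on UNIV \<phi>" for \<phi>
  proof -
    have "continuous_on UNIV (\<lambda>t. I \<phi> (c t))"
      by (rule continuous_on_compose2[OF I_cont[OF that] c_cont]) (use c_in in auto)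
    then have "continuous_on UNIV (P \<phi>)"
      unfolding P_def by (intro continuous_intros)
    moreover have "bounded (range (P \<phi>))"
    proof (rule bounded_subset)
      show "bounded ((\<lambda>s. x\<^sub>0 + I \<phi> s - I \<phi> 0) ` {-h..h})"
        by (intro compact_imp_bounded compact_continuous_image continuous_intros I_cont that) auto
    qed (use c_in in \<open>auto simp: P_def\<close>)
    ultimately show ?thesis by (simp add: bcontfun_def)
  qed
  define T where "T \<psi> = Bcontfun (P (apply_bcontfun \<psi>))" for \<psi> :: "real \<Rightarrow>\<^sub>C 'a"
  have T: "apply_bcontfun (T \<psi>) = P (apply_bcontfun \<psi>)" for \<psi>
    unfolding T_def by (rule Bcontfun_inverse) (simp add: P_bcont)
  have I_diff: "dist (I \<psi> t) (I \<xi> t) \<le> 2 * h * K * dist \<psi> \<xi>"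
    if "t \<in> {-h..h}" for \<psi> \<xi> :: "real \<Rightarrow>\<^sub>C 'a" and t
  proof -
    have "I \<psi> t - I \<xi> t = integral {-h..t} (\<lambda>s. g (\<psi> s) - g (\<xi> s))"
      unfolding I_def by (intro integral_diff[symmetric] integrable_continuous_real g\<phi>_cont) auto
    also have "norm \<dots> \<le> (K * dist \<psi> \<xi>) * (t - (-h))"
    proof (rule integral_bound)
      fix s
      have "norm (g (\<psi> s) - g (\<xi> s)) \<le> K * dist (\<psi> s) (\<xi> s)"
        using lipschitz_onD[OF g] by (auto simp: dist_norm)
      also have "\<dots> \<le> K * dist \<psi> \<xi>"
        by (intro mult_left_mono dist_bounded K0)
      finally show "norm (g (\<psi> s) - g (\<xi> s)) \<le> K * dist \<psi> \<xi>" .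
    qed (use that in \<open>auto intro!: continuous_intros g\<phi>_cont\<close>)
    also have "\<dots> \<le> (K * dist \<psi> \<xi>) * (2 * h)"
      using that K0 by (intro mult_left_mono) auto
    finally show ?thesis by (simp add: dist_norm mult_ac)
  qed
  have "dist (T \<psi>) (T \<xi>) \<le> (4 * h * K) * dist \<psi> \<xi>" for \<psi> \<xi>
  proof (rule dist_bound)
    fix t
    have "dist (T \<psi> t) (T \<xi> t) \<le> dist (I \<psi> (c t)) (I \<xi> (c t)) + dist (I \<psi> 0) (I \<xi> 0)"
      unfolding T P_def dist_norm by norm
    also have "\<dots> \<le> 2 * h * K * dist \<psi> \<xi> + 2 * h * K * dist \<psi> \<xi>"
      using h by (intro add_mono I_diff c_in) auto
    finally show "dist (T \<psi> t) (T \<xi> t) \<le> (4 * h * K) * dist \<psi> \<xi>" by (simp add: algebra_simps)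
  qed
  then obtain \<psi> where "T \<psi> = \<psi>"
    using banach_fix_type[of "4 * h * K" T] hK h K0 by auto
  then have fixpoint: "\<psi> t = P \<psi> t" for t using T[of \<psi>] by simp
  show ?thesis
  proof
    show "\<psi> 0 = x\<^sub>0" using fixpoint[of 0] h by (simp add: P_def c_id)
  next
    fix t assume t: "t \<in> {-h<..<h}"
    have "((\<lambda>s. I \<psi> s) has_vector_derivative g (\<psi> t)) (at t within {-h..h})"
      unfolding I_def
      by (rule integral_has_vector_derivative) (use t in \<open>auto intro: g\<phi>_cont\<close>)
    then have "(I \<psi> has_vector_derivative g (\<psi> t)) (at t)"
      using t at_within_Icc_at[of "-h" t h] by simp
    then have "((\<lambda>s. x\<^sub>0 + I \<psi> s - I \<psi> 0) has_vector_derivative g (\<psi> t)) (at t)"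
      by (auto intro!: derivative_eq_intros)
    then show "(\<psi> has_vector_derivative g (\<psi> t)) (at t)"
      by (rule has_vector_derivative_transform_within_open[where S="{-h<..<h}"])
         (use t in \<open>auto simp: fixpoint P_def c_id\<close>)
  qed
qed

text \<open>
  Precomposing \<open>F\<close> with the nearest-point retraction onto the ball, which is nonexpansive, makes it
  globally Lipschitz; by continuity a solution of the modified equation stays in the ball for a
  short time, where the modification has no effect.  The solution is Lipschitz there because \<open>F\<close> is
  bounded on the ball.
\<close>

lemma picard_lindeloef_local:
  fixes F :: "'a::euclidean_space \<Rightarrow> 'a"
  assumes F: "K-lipschitz_on (cball x\<^sub>0 r) F" and r: "0 < r"
  obtains \<delta> M \<phi> where "0 < \<delta>" "\<phi> 0 = x\<^sub>0" "M-lipschitz_on {-\<delta><..<\<delta>} \<phi>"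
    and "\<And>t. t \<in> {-\<delta><..<\<delta>} \<Longrightarrow> (\<phi> has_vector_derivative F (\<phi> t)) (at t)"
proof -
  define B where "B = cball x\<^sub>0 r"
  have B: "convex B" "closed B" "B \<noteq> {}" "compact B" using r by (auto simp: B_def)
  have K0: "0 \<le> K" using F by (rule lipschitz_on_nonneg)
  have "K-lipschitz_on UNIV (\<lambda>x. F (closest_point B x))"
  proof (rule lipschitz_onI)
    fix x y
    have "dist (F (closest_point B x)) (F (closest_point B y))
        \<le> K * dist (closest_point B x) (closest_point B y)"
      using B by (intro lipschitz_onD[OF F]) (auto simp flip: B_def intro!: closest_point_in_set)
    also have "\<dots> \<le> K * dist x y"
      using B by (intro mult_left_mono closest_point_lipschitz K0)
    finally show "dist (F (closest_point B x)) (F (closest_point B y)) \<le> K * dist x y" .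
  qed (rule K0)
  \<comment> \<open>The summand \<open>1\<close> keeps the contraction factor strictly below \<open>1\<close> and covers \<open>K = 0\<close>.\<close>
  moreover define h where "h = 1 / (4 * K + 1)"
  have "0 < h" "4 * h * K < 1" using K0 by (auto simp: h_def field_simps)
  ultimately obtain \<phi> where \<phi>0: "\<phi> 0 = x\<^sub>0"
    and \<phi>': "\<And>t. t \<in> {-h<..<h} \<Longrightarrow>
      (\<phi> has_vector_derivative F (closest_point B (\<phi> t))) (at t)"
    using picard_lindeloef_global_lipschitz by blast
  have "isCont \<phi> 0"
    using \<phi>'[of 0] \<open>0 < h\<close> has_vector_derivative_continuous by auto
  then obtain d where d: "0 < d" "\<And>t. \<bar>t\<bar> < d \<Longrightarrow> dist (\<phi> t) x\<^sub>0 < r"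
    using r \<phi>0 by (auto simp: continuous_at_eps_delta dist_real_def)
  define \<delta> where "\<delta> = min d h"
  have inB: "\<phi> t \<in> B" if "t \<in> {-\<delta><..<\<delta>}" for t
  proof -
    have "\<bar>t\<bar> < d" using that by (auto simp: \<delta>_def)
    then show ?thesis using d(2)[of t] by (simp add: B_def dist_commute)
  qed
  have F_\<phi>: "(\<phi> has_vector_derivative F (\<phi> t)) (at t)" if "t \<in> {-\<delta><..<\<delta>}" for t
  proof -
    have "t \<in> {-h<..<h}" using that by (auto simp: \<delta>_def)
    then show ?thesis using \<phi>'[of t] closest_point_self[OF inB[OF that]] by simp
  qed
  have "bounded (F ` B)"
    using B lipschitz_on_continuous_on[OF F]
    by (intro compact_imp_bounded compact_continuous_image) (auto simp: B_def)
  then obtain M where M: "0 < M" "\<And>x. x \<in> B \<Longrightarrow> norm (F x) \<le> M"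
    unfolding bounded_pos by auto
  have "M-lipschitz_on {-\<delta><..<\<delta>} \<phi>"
  proof (rule bounded_derivative_imp_lipschitz)
    fix t assume t: "t \<in> {-\<delta><..<\<delta>}"
    show "(\<phi> has_derivative (\<lambda>s. s *\<^sub>R F (\<phi> t))) (at t within {-\<delta><..<\<delta>})"
      using F_\<phi>[OF t] has_derivative_at_withinI unfolding has_vector_derivative_def by blast
    have "norm (s *\<^sub>R F (\<phi> t)) \<le> M * norm s" for s
      using mult_left_mono[OF M(2)[OF inB[OF t]], of "\<bar>s\<bar>"] by (simp add: mult.commute)
    then show "onorm (\<lambda>s. s *\<^sub>R F (\<phi> t)) \<le> M" by (rule onorm_le)
  qed (use M in auto)
  then show ?thesis
    using that[of \<delta> \<phi> M] d(1) \<open>0 < h\<close> \<phi>0 F_\<phi> by (auto simp: \<delta>_def)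
qed

section \<open>Rounding to lattice points\<close>

lemma infnorm_le_iff_cart: "infnorm (x :: real ^ 'k) \<le> c \<longleftrightarrow> (\<forall>i. \<bar>x $ i\<bar> \<le> c)"
  unfolding infnorm_Max
  by (subst Max_le_iff) (auto simp: Basis_vec_def inner_axis)

lemma Metric_space_infnorm:
  "Metric_space UNIV (\<lambda>p q :: 'a::euclidean_space. infnorm (p - q))"
proof
  show "infnorm (x - z) \<le> infnorm (x - y) + infnorm (y - z)" for x y z :: 'a
    using infnorm_triangle[of "x - y" "y - z"] by simp
qed (simp_all add: infnorm_pos_le infnorm_eq_0 infnorm_sub)

lemma ex_near_lattice_point:
  fixes x :: "real ^ 'k"
  assumes "\<eta> > 0"
  obtains q where "q \<in> lattice_points UNIV \<eta>" "infnorm (q - x) \<le> \<eta> / 2"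
proof
  define q :: "real ^ 'k" where "q = (\<chi> i. of_int (round (x $ i / \<eta>)) * \<eta>)"
  show "q \<in> lattice_points UNIV \<eta>" by (auto simp: lattice_points_def q_def)
  show "infnorm (q - x) \<le> \<eta> / 2"
    unfolding infnorm_le_iff_cart
  proof
    fix i
    have "\<bar>(q - x) $ i\<bar> = \<bar>of_int (round (x $ i / \<eta>)) - x $ i / \<eta>\<bar> * \<eta>"
      using assms by (simp add: q_def abs_mult_pos' field_simps)
    also have "\<dots> \<le> 1 / 2 * \<eta>"
      using assms of_int_round_abs_le by (intro mult_right_mono) auto
    finally show "\<bar>(q - x) $ i\<bar> \<le> \<eta> / 2" by simp
  qed
qed

lemma round_towards_zero:
  fixes x \<mu> :: real
  assumes "\<mu> > 0"
  obtains k :: int where "of_int k * \<mu> \<in> closed_segment 0 x" "\<bar>of_int k * \<mu> - x\<bar> \<le> \<mu>"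
proof (cases "0 \<le> x")
  case True
  have "0 \<le> of_int \<lfloor>x / \<mu>\<rfloor> * \<mu>" using True assms by simp
  moreover have "of_int \<lfloor>x / \<mu>\<rfloor> * \<mu> \<le> x"
    using assms of_int_floor_le[of "x / \<mu>"] by (simp only: pos_le_divide_eq)
  moreover have "x \<le> of_int \<lfloor>x / \<mu>\<rfloor> * \<mu> + \<mu>"
    using assms real_of_int_floor_add_one_ge[of "x / \<mu>"] by (simp add: field_simps)
  ultimately show ?thesis using that[of "\<lfloor>x / \<mu>\<rfloor>"] True
    by (auto simp: closed_segment_eq_real_ivl)
next
  case False
  have "of_int \<lceil>x / \<mu>\<rceil> * \<mu> \<le> 0"
    using False assms by (simp add: mult_le_0_iff ceiling_le_iff divide_le_0_iff)
  moreover have "x \<le> of_int \<lceil>x / \<mu>\<rceil> * \<mu>"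
    using assms le_of_int_ceiling[of "x / \<mu>"] by (simp only: pos_divide_le_eq)
  moreover have "of_int \<lceil>x / \<mu>\<rceil> * \<mu> - \<mu> \<le> x"
    using assms of_int_ceiling_diff_one_le[of "x / \<mu>"] by (simp add: field_simps)
  ultimately show ?thesis using that[of "\<lceil>x / \<mu>\<rceil>"] False
    by (auto simp: closed_segment_eq_real_ivl)
qed

text \<open>
  Rounding to the nearest lattice point may leave the box.  Rounding towards zero does not, since
  each coordinate moves along the segment to \<open>0\<close>; the price is an error of \<open>\<mu>\<close> instead of \<open>\<mu> / 2\<close>.
\<close>

lemma ex_near_lattice_point_box:
  fixes u :: "real ^ 'k"
  assumes "\<mu> > 0" "0 \<in> cbox a b" "u \<in> cbox a b"
  obtains v where "v \<in> lattice_points (cbox a b) \<mu>" "infnorm (v - u) \<le> \<mu>"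
proof -
  have "\<exists>k::int. of_int k * \<mu> \<in> closed_segment 0 (u $ i) \<and> \<bar>of_int k * \<mu> - u $ i\<bar> \<le> \<mu>" for i
    using round_towards_zero[OF assms(1)] by metis
  then obtain k :: "'k \<Rightarrow> int" where k:
    "\<And>i. of_int (k i) * \<mu> \<in> closed_segment 0 (u $ i)"
    "\<And>i. \<bar>of_int (k i) * \<mu> - u $ i\<bar> \<le> \<mu>"
    by metis
  define v :: "real ^ 'k" where "v = (\<chi> i. of_int (k i) * \<mu>)"
  have "v \<in> cbox a b"
    unfolding mem_box_cart
  proof
    fix i
    show "a $ i \<le> v $ i \<and> v $ i \<le> b $ i"
      using k(1)[of i] assms(2,3)[unfolded mem_box_cart, rule_format, of i]
      by (auto simp: v_def closed_segment_eq_real_ivl split: if_splits)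
  qed
  then show ?thesis
    using that[of v] k(2) by (auto simp: v_def lattice_points_def infnorm_le_iff_cart)
qed

section \<open>Trajectories under constant inputs\<close>

lemma abs_continuous_on_Icc_if_lipschitz:
  assumes "M-lipschitz_on {c..d} x"
  shows "abs_continuous_on_Icc c d x"
  unfolding abs_continuous_on_Icc_def
proof (intro allI impI)
  fix e :: real assume e: "e > 0"
  have M0: "0 \<le> M" using assms by (rule lipschitz_on_nonneg)
  show "\<exists>\<delta>>0. \<forall>(N::nat) s t.
      (\<forall>i<N. c \<le> s i \<and> s i \<le> t i \<and> t i \<le> d) \<and>
      (\<forall>i<N. \<forall>j<N. i \<noteq> j \<longrightarrow> {s i<..<t i} \<inter> {s j<..<t j} = {}) \<and>
      (\<Sum>i<N. t i - s i) < \<delta> \<longrightarrow>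
      (\<Sum>i<N. infnorm (x (t i) - x (s i))) < e"
  proof (intro exI conjI allI impI; (elim conjE)?)
    \<comment> \<open>\<open>M + 1\<close> replaces \<open>M\<close> because the latter may be zero.\<close>
    show "0 < e / (M + 1)" using e M0 by simp
  next
    fix N :: nat and s t
    assume st: "\<forall>i<N. c \<le> s i \<and> s i \<le> t i \<and> t i \<le> d"
      and small: "(\<Sum>i<N. t i - s i) < e / (M + 1)"
    have "(\<Sum>i<N. infnorm (x (t i) - x (s i))) \<le> (\<Sum>i<N. (M + 1) * (t i - s i))"
    proof (intro sum_mono)
      fix i assume "i \<in> {..<N}"
      then have i: "c \<le> s i" "s i \<le> t i" "t i \<le> d" using st by auto
      have "infnorm (x (t i) - x (s i)) \<le> dist (x (t i)) (x (s i))"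
        by (simp add: dist_norm infnorm_le_norm)
      also have "\<dots> \<le> M * dist (t i) (s i)"
        using i by (intro lipschitz_onD[OF assms]) auto
      also have "\<dots> \<le> (M + 1) * (t i - s i)"
        using i M0 by (simp add: dist_real_def algebra_simps)
      finally show "infnorm (x (t i) - x (s i)) \<le> (M + 1) * (t i - s i)" .
    qed
    also have "\<dots> = (M + 1) * (\<Sum>i<N. t i - s i)" by (simp add: sum_distrib_left)
    also have "\<dots> < e" using small M0 by (simp add: field_simps)
    finally show "(\<Sum>i<N. infnorm (x (t i) - x (s i))) < e" .
  qed
qed

text \<open>
  A constant input turns the control system into an autonomous equation that is Lipschitz on compact
  sets.  Its local solution is a trajectory, which forward completeness continues past \<open>\<tau>\<close>.
\<close>

lemma flow_defined_constant_input:
  fixes S :: "('n::finite, 'm::finite) control_system"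
  assumes S: "is_control_system S" "forward_complete S"
    and u: "u \<in> input_space S" "constant_input u \<in> inputs S" and "0 \<le> \<tau>"
  shows "flow_defined S \<tau> x\<^sub>0 (constant_input u)"
proof -
  let ?F = "\<lambda>x. dynamics S x u"
  obtain \<kappa> where "\<kappa> > 0" and \<kappa>: "\<And>x y. x \<in> cball x\<^sub>0 1 \<Longrightarrow> y \<in> cball x\<^sub>0 1 \<Longrightarrow>
      infnorm (?F x - ?F y) \<le> \<kappa> * infnorm (x - y)"
    using S(1) u(1) compact_cball unfolding is_control_system_def by meson
  \<comment> \<open>The factor \<open>sqrt n\<close> is the cost of passing from the infinity norm to the Euclidean one.\<close>
  have "(sqrt DIM(real ^ 'n) * \<kappa>)-lipschitz_on (cball x\<^sub>0 1) ?F"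
  proof (rule lipschitz_onI)
    fix x y assume xy: "x \<in> cball x\<^sub>0 1" "y \<in> cball x\<^sub>0 1"
    have "dist (?F x) (?F y) \<le> sqrt DIM(real ^ 'n) * infnorm (?F x - ?F y)"
      unfolding dist_norm by (rule norm_le_infnorm)
    also have "\<dots> \<le> sqrt DIM(real ^ 'n) * (\<kappa> * infnorm (x - y))"
      by (intro mult_left_mono \<kappa> xy) auto
    also have "\<dots> \<le> sqrt DIM(real ^ 'n) * (\<kappa> * dist x y)"
      using \<open>\<kappa> > 0\<close> by (intro mult_left_mono) (auto simp: dist_norm infnorm_le_norm)
    finally show "dist (?F x) (?F y) \<le> sqrt DIM(real ^ 'n) * \<kappa> * dist x y"
      by (simp add: mult.assoc)
  qed (use \<open>\<kappa> > 0\<close> in simp)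
  from picard_lindeloef_local[OF this zero_less_one] obtain \<delta> M \<phi>
    where \<delta>: "0 < \<delta>" and \<phi>: "\<phi> 0 = x\<^sub>0" "M-lipschitz_on {-\<delta><..<\<delta>} \<phi>"
      "\<And>t. t \<in> {-\<delta><..<\<delta>} \<Longrightarrow> (\<phi> has_vector_derivative ?F (\<phi> t)) (at t)"
    by blast
  have "trajectory_under S (constant_input u) (ereal (-\<delta>)) (ereal \<delta>) \<phi>"
    unfolding trajectory_under_def einterval_eq
  proof (intro conjI)
    show "locally_abs_continuous_on {-\<delta><..<\<delta>} \<phi>"
      unfolding locally_abs_continuous_on_def
      using abs_continuous_on_Icc_if_lipschitz lipschitz_on_subset[OF \<phi>(2)] by blast
    show "AE t in lebesgue_on {-\<delta><..<\<delta>}.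
        (\<phi> has_vector_derivative dynamics S (\<phi> t) (the (constant_input u t))) (at t)"
      by (rule AE_I2) (simp add: constant_input_def \<phi>(3))
  qed (use \<delta> u(2) in \<open>auto simp: constant_input_def\<close>)
  then obtain y where "trajectory_under S (constant_input u) (ereal (-\<delta>)) \<infinity> y"
    and "\<forall>t\<in>einterval (ereal (-\<delta>)) (ereal \<delta>). y t = \<phi> t"
    using S(2) unfolding forward_complete_def by meson
  moreover from this have "y 0 = x\<^sub>0" using \<delta> \<phi>(1) by simp
  moreover have "\<tau> \<in> einterval (ereal (-\<delta>)) \<infinity>" using \<delta> \<open>0 \<le> \<tau>\<close> by simp
  ultimately show ?thesis unfolding flow_defined_def reaches_def by blast
qed

text \<open>
  Thus a constant input obtained by rounding a label is a label as soon as it lies in the input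
  space.
\<close>

lemma sampled_labels_eq:
  assumes "is_control_system S" "forward_complete S" "0 \<le> \<tau>"
    and "\<forall>u\<in>input_space S. constant_input u \<in> inputs S"
  shows "sampled_labels \<tau> S = input_space S"
  using assms flow_defined_constant_input unfolding sampled_labels_def by blast

section \<open>The bisimulation\<close>

lemma sup_norm_diff_constant_input:
  "sup_norm_diff (constant_input u) (constant_input v) = ereal (infnorm (u - v))"
  unfolding sup_norm_diff_def constant_input_def option.sel
proof (rule esssup_const)
  have "emeasure lborel {0..1::real} \<le> emeasure lborel {0::real..}"
    by (rule emeasure_mono) auto
  then show "emeasure (lebesgue_on {0::real..}) (space (lebesgue_on {0..})) \<noteq> 0"
    by (auto simp: emeasure_restrict_space)
qed

lemma class_Kinf_mono:
  assumes "class_Kinf \<gamma>" "0 \<le> r" "r \<le> s"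
  shows "\<gamma> r \<le> \<gamma> s"
  using assms strict_mono_on_imp_mono_on[of "{0..}" \<gamma>]
  by (auto simp: class_Kinf_def class_K_def mono_on_def)

lemma class_Kinf_nonneg:
  assumes "class_Kinf \<gamma>" "0 \<le> r"
  shows "0 \<le> \<gamma> r"
  using assms by (auto simp: class_Kinf_def class_K_def)

lemma flow_constant_inputs_close:
  assumes "delta_ISS_estimate S \<beta> \<gamma>" "class_KL \<beta>" "class_Kinf \<gamma>"
    and "constant_input u \<in> inputs S" "constant_input v \<in> inputs S" "0 \<le> \<tau>"
    and "infnorm (x - y) \<le> \<epsilon>" "infnorm (u - v) \<le> \<mu>"
  shows "infnorm (flow S \<tau> x (constant_input u) - flow S \<tau> y (constant_input v))
    \<le> \<beta> \<epsilon> \<tau> + \<gamma> \<mu>"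
proof -
  have "infnorm (flow S \<tau> x (constant_input u) - flow S \<tau> y (constant_input v))
      \<le> \<beta> (infnorm (x - y)) \<tau> + \<gamma> (infnorm (u - v))"
    using assms(1,4-6) sup_norm_diff_constant_input[of u v]
    unfolding delta_ISS_estimate_def by force
  also have "\<dots> \<le> \<beta> \<epsilon> \<tau> + \<gamma> \<mu>"
    using assms class_Kinf_mono[of "\<lambda>r. \<beta> r \<tau>"] class_Kinf_mono[of \<gamma>]
    by (intro add_mono) (auto simp: class_KL_def infnorm_pos_le)
  finally show ?thesis .
qed

theorem theorem5p1:
  fixes S :: "('n::finite, 'm::finite) control_system"
    and a b :: "real ^ 'm"
    and \<beta> :: "real \<Rightarrow> real \<Rightarrow> real" and \<gamma> :: "real \<Rightarrow> real"
    and \<epsilon> \<tau> \<eta> \<mu> :: real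
  assumes "is_control_system S"
    and "input_space S = cbox a b" and "\<forall>i. a $ i < b $ i" and "0 \<in> input_space S"
    and "\<forall>u\<in>input_space S. constant_input u \<in> inputs S"
    and "\<epsilon> > 0"
    and "delta_ISS S"
    and "class_KL \<beta>" and "class_Kinf \<gamma>" and "delta_ISS_estimate S \<beta> \<gamma>"
    and "\<tau> > 0" and "\<eta> > 0" and "\<mu> > 0"
    and "\<beta> \<epsilon> \<tau> + \<gamma> \<mu> + \<eta> / 2 \<le> \<epsilon>"
  shows "approx_bisimilar \<epsilon> (sampled_system \<tau> S) (quantized_system \<tau> \<eta> \<mu> S)"
proof -
  let ?\<Lambda> = "lattice_points UNIV \<eta> :: (real ^ 'n) set"
  let ?T1 = "sampled_system \<tau> S" and ?T2 = "quantized_system \<tau> \<eta> \<mu> S"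
  define R where "R = {(x, q). q \<in> ?\<Lambda> \<and> infnorm (x - q) \<le> \<epsilon>}"
  have labels: "sampled_labels \<tau> S = input_space S"
    using assms by (intro sampled_labels_eq) (auto simp: delta_ISS_def)
  \<comment> \<open>The estimate behind both directions of the bisimulation; the converse one uses \<open>u = v\<close>.\<close>
  have close: "infnorm (flow S \<tau> x (constant_input u) - p) \<le> \<epsilon>"
    if "infnorm (x - q) \<le> \<epsilon>" "infnorm (v - u) \<le> \<mu>" "u \<in> input_space S" "v \<in> input_space S"
      "infnorm (p - flow S \<tau> q (constant_input v)) \<le> \<eta> / 2" for x q p u v
  proof -
    have "infnorm (flow S \<tau> x (constant_input u) - flow S \<tau> q (constant_input v)) \<le> \<beta> \<epsilon> \<tau> + \<gamma> \<mu>"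
      using assms that by (intro flow_constant_inputs_close) (auto simp: infnorm_sub)
    then show ?thesis
      using infnorm_triangle[of "flow S \<tau> x (constant_input u) - flow S \<tau> q (constant_input v)"
          "flow S \<tau> q (constant_input v) - p"] that(5) assms(14)
        infnorm_sub[of p "flow S \<tau> q (constant_input v)"] by simp
  qed
  have "metric_transition_system ?T1" "metric_transition_system ?T2" "same_outputs ?T1 ?T2"
    by (auto simp: metric_transition_system_def same_outputs_def sampled_system_def
        quantized_system_def Metric_space_infnorm)
  moreover have "approx_bisimulation \<epsilon> ?T1 ?T2 R"
    unfolding approx_bisimulation_def
  proof (intro conjI ballI, safe)
    show "(x, q) \<in> R \<Longrightarrow> x \<in> states ?T1" "(x, q) \<in> R \<Longrightarrow> q \<in> states ?T2" for x q
      by (auto simp: R_def sampled_system_def quantized_system_def)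
    show "(x, q) \<in> R \<Longrightarrow> output_dist ?T1 (output_map ?T1 x) (output_map ?T2 q) \<le> \<epsilon>" for x q
      by (auto simp: R_def sampled_system_def quantized_system_def)
  next
    fix x q u p assume "(x, q) \<in> R" "(x, u, p) \<in> transitions ?T1"
    then have xq: "q \<in> ?\<Lambda>" "infnorm (x - q) \<le> \<epsilon>"
      and u: "u \<in> input_space S" and p: "p = flow S \<tau> x (constant_input u)"
      by (auto simp: R_def sampled_system_def labels)
    obtain v where v: "v \<in> lattice_points (input_space S) \<mu>" "infnorm (v - u) \<le> \<mu>"
      using ex_near_lattice_point_box u assms(2,4,13) by metis
    obtain p' where p': "p' \<in> ?\<Lambda>" "infnorm (p' - flow S \<tau> q (constant_input v)) \<le> \<eta> / 2"
      using ex_near_lattice_point assms(12) by blast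
    have "(q, v, p') \<in> transitions ?T2"
      using xq v p' by (simp add: quantized_system_def labels)
    moreover have "(p, p') \<in> R"
      using close[OF xq(2) v(2) u _ p'(2)] v(1) p'(1) by (simp add: R_def p lattice_points_def)
    ultimately show "\<exists>v p'. (q, v, p') \<in> transitions ?T2 \<and> (p, p') \<in> R" by blast
  next
    fix x q v p' assume "(x, q) \<in> R" "(q, v, p') \<in> transitions ?T2"
    then have xq: "infnorm (x - q) \<le> \<epsilon>" and v: "v \<in> input_space S" and p': "p' \<in> ?\<Lambda>"
        "infnorm (p' - flow S \<tau> q (constant_input v)) \<le> \<eta> / 2"
      by (auto simp: R_def quantized_system_def labels lattice_points_def)
    let ?p = "flow S \<tau> x (constant_input v)"
    have "(x, v, ?p) \<in> transitions ?T1"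
      using v by (simp add: sampled_system_def labels)
    moreover have "(?p, p') \<in> R"
      using close[OF xq _ v v p'(2)] p'(1) assms(13) by (simp add: R_def infnorm_0)
    ultimately show "\<exists>u p. (x, u, p) \<in> transitions ?T1 \<and> (p, p') \<in> R" by blast
  qed
  moreover have "R `` states ?T1 = states ?T2"
  proof -
    have "(q, q) \<in> R" if "q \<in> ?\<Lambda>" for q
      using that assms(6) by (simp add: R_def infnorm_0)
    moreover have "R \<subseteq> UNIV \<times> ?\<Lambda>" by (auto simp: R_def)
    ultimately have "R `` UNIV = ?\<Lambda>" by blast
    then show ?thesis by (simp add: sampled_system_def quantized_system_def)
  qed
  \<comment> \<open>Since \<open>\<beta> \<epsilon> \<tau>\<close> and \<open>\<gamma> \<mu>\<close> are nonnegative, \<open>\<eta> / 2 \<le> \<epsilon>\<close>: every state is close to the lattice.\<close>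
  moreover have "R\<inverse> `` states ?T2 = states ?T1"
  proof -
    have "0 \<le> \<beta> \<epsilon> \<tau>" "0 \<le> \<gamma> \<mu>"
      using class_Kinf_nonneg[of "\<lambda>r. \<beta> r \<tau>" \<epsilon>] class_Kinf_nonneg[of \<gamma> \<mu>] assms
      by (auto simp: class_KL_def)
    then have "\<eta> / 2 \<le> \<epsilon>" using assms(14) by simp
    have "\<exists>q\<in>?\<Lambda>. infnorm (x - q) \<le> \<epsilon>" for x
    proof -
      obtain q where "q \<in> ?\<Lambda>" "infnorm (q - x) \<le> \<eta> / 2"
        using ex_near_lattice_point assms(12) by blast
      with \<open>\<eta> / 2 \<le> \<epsilon>\<close> show ?thesis using infnorm_sub[of q x] by force
    qed
    then show ?thesis by (force simp: R_def sampled_system_def quantized_system_def)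
  qed
  ultimately show ?thesis unfolding approx_bisimilar_def by blast
qed

end
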